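(* Let $(u,v)$ be an Anderson pair, located as $(u,v)=(x_{j-1},x_j)$ in some row $(x_i)_{i\in\mathbb Z}$ of the extended Fibonacci Zeckendorf array, and let $\delta(u,v)=-u+\phi^{-1}v$ and $m=\lceil\log_\phi|\delta(u,v)|\rceil$. Then $$j=\begin{cases}2\lfloor -m/2\rfloor & \text{if }\delta(u,v)>0,\\ 2\lfloor (1-m)/2\rfloor-1 & \text{otherwise,}\end{cases}$$ and the entry of that row in column $-1$ (which identifies the row) is $x_{-1}=uF_{-1-j}+vF_{-j}$.
   Context: $F_0=0$, $F_1=1$, $F_i=F_{i-1}+F_{i-2}$, extended to negative indices by $F_{-i}=(-1)^{i+1}F_i$; $\phi=(1+\sqrt5)/2$. For a bit string $\beta=\langle\beta_1\ldots\beta_\ell\rangle$, $\mathrm{FibSum}(\beta)=\sum_{i=1}^\ell\beta_iF_{i+1}$. The Zeckendorf representation of a positive integer $m$ is the unique bit string $\beta$ with $\mathrm{FibSum}(\beta)=m$, $\beta_\ell=1$, and no two consecutive 1s. Let $a_1<a_2<\cdots$ be the positive integers whose Zeckendorf representation has $\beta_1=1$. The extended Fibonacci Zeckendorf array has, for each $n\ge1$, a row $(x^{(n)}_i)_{i\in\mathbb Z}$ of integers determined by $x^{(n)}_1=a_n$, $x^{(n)}_2=\mathrm{FibSum}(\langle 0\rangle\|\beta)$ where $\beta$ is the Zeckendorf representation of $a_n$, and $x^{(n)}_{i+1}=x^{(n)}_i+x^{(n)}_{i-1}$ for all $i\in\mathbb Z$; $i$ is the column index. An Anderson pair is a pair of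 integers $(u,v)$ occurring as adjacent entries $(x^{(n)}_{j-1},x^{(n)}_j)$ of some row; $v$ is then said to be in column $j$. (Anderson showed these are exactly the integer pairs with $v\phi+u>0$, each occurring once.) Rows are identified by their column $-1$ entries. *)

theory Defs
  imports Complex_Main "HOL-Number_Theory.Fib" "HOL-Library.Infinite_Set"
begin

definition phi :: real where
  "phi = (1 + sqrt 5) / 2"

definition fibz :: "int \<Rightarrow> int" where
  "fibz i = (if i \<ge> 0 then int (fib (nat i))
             else (-1) ^ (nat (- i) + 1) * int (fib (nat (- i))))"

text \<open>Bit strings are lists of booleans. The bit with index \<open>i\<close> of the mathematical
  text (counted from 1) is the list element \<open>\<beta> ! (i - 1)\<close>.\<close>

definition fib_sum :: "bool list \<Rightarrow> nat" where
  "fib_sum \<beta> = (\<Sum>i = 1..length \<beta>. of_bool (\<beta> ! (i - 1)) * fib (i + 1))"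

definition is_zeckendorf :: "nat \<Rightarrow> bool list \<Rightarrow> bool" where
  "is_zeckendorf m \<beta> \<longleftrightarrow>
     fib_sum \<beta> = m \<and> \<beta> \<noteq> [] \<and> last \<beta> \<and>
     (\<forall>i. Suc i < length \<beta> \<longrightarrow> \<not> (\<beta> ! i \<and> \<beta> ! Suc i))"

definition zeckendorf :: "nat \<Rightarrow> bool list" where
  "zeckendorf m = (THE \<beta>. is_zeckendorf m \<beta>)"

text \<open>The library function \<open>enumerate\<close> counts from 0, whereas the sequence of the
  positive integers with lowest Zeckendorf bit 1 is indexed from 1; the value at index 0
  is irrelevant.\<close>

definition zeck_a :: "nat \<Rightarrow> nat" where
  "zeck_a n = enumerate {m. m > 0 \<and> zeckendorf m ! 0} (n - 1)"

definition is_zeck_row :: "nat \<Rightarrow> (int \<Rightarrow> int) \<Rightarrow> bool" where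
  "is_zeck_row n x \<longleftrightarrow>
     x 1 = int (zeck_a n) \<and>
     x 2 = int (fib_sum (False # zeckendorf (zeck_a n))) \<and>
     (\<forall>i. x (i + 1) = x i + x (i - 1))"

definition zeck_row :: "nat \<Rightarrow> int \<Rightarrow> int" where
  "zeck_row n = (THE x. is_zeck_row n x)"

definition anderson_pair :: "int \<Rightarrow> int \<Rightarrow> bool" where
  "anderson_pair u v \<longleftrightarrow>
     (\<exists>n\<ge>1. \<exists>j. u = zeck_row n (j - 1) \<and> v = zeck_row n j)"

definition delta :: "int \<Rightarrow> int \<Rightarrow> real" where
  "delta u v = - of_int u + inverse phi * of_int v"

lemma fibz_rec: "fibz (i + 1) = fibz i + fibz (i - 1)"
proof -
  consider (pos) k where "i = int k + 1" | (zero) "i = 0" | (neg) k where "i = - int k - 1"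
    by (cases i rule: int_cases3) (auto, metis Suc_pred' of_nat_Suc add.commute,
        metis Suc_pred' of_nat_Suc add.commute add_uminus_conv_diff minus_add_distrib)
  then show ?thesis
  proof cases
    case pos
    have "nat (i + 1) = Suc (Suc k)" "nat i = Suc k" "nat (i - 1) = k"
      using pos by auto
    then show ?thesis using pos by (simp add: fibz_def)
  next
    case zero
    then show ?thesis by (simp add: fibz_def)
  next
    case neg
    have "nat (- i) = Suc k" "nat (- (i - 1)) = Suc (Suc k)" "nat (- (i + 1)) = k"
      using neg by auto
    then have "fibz i = (-1) ^ k * int (fib (Suc k))"
      "fibz (i - 1) = - ((-1) ^ k) * int (fib (Suc (Suc k)))"
      "fibz (i + 1) = - ((-1) ^ k) * int (fib k)"
      using neg by (simp_all add: fibz_def)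
    then show ?thesis by (simp add: algebra_simps)
  qed
qed

lemma fib_type_unique:
  fixes x y :: "int \<Rightarrow> int"
  assumes "x 1 = y 1" "x 2 = y 2"
    and x: "\<And>i. x (i + 1) = x i + x (i - 1)" and y: "\<And>i. y (i + 1) = y i + y (i - 1)"
  shows "x = y"
proof
  fix i
  have "x i = y i \<and> x (i + 1) = y (i + 1)"
  proof (induction i rule: int_induct[where k = 1])
    case base
    then show ?case using assms(1,2) by simp
  next
    case (step1 i)
    then show ?case using x[of "i + 1"] y[of "i + 1"] by simp
  next
    case (step2 i)
    then show ?case using x[of i] y[of i] by simp
  qed
  then show "x i = y i" ..
qed

lemma ex1_zeck_row: "\<exists>!x. is_zeck_row n x"
proof (rule ex_ex1I)
  define a b where "a = int (zeck_a n)" and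
    "b = int (fib_sum (False # zeckendorf (zeck_a n)))"
  let ?x = "\<lambda>i. b * fibz (i - 1) + a * fibz (i - 2)"
  have "?x (i + 1) = ?x i + ?x (i - 1)" for i
    using fibz_rec[of "i - 1"] fibz_rec[of "i - 2"] by (simp add: algebra_simps)
  moreover have "fibz 0 = 0" "fibz 1 = 1" "fibz (- 1) = 1"
    by (auto simp: fibz_def)
  ultimately have "is_zeck_row n ?x"
    unfolding is_zeck_row_def a_def b_def by simp
  then show "\<exists>x. is_zeck_row n x" by blast
next
  show "x = y" if "is_zeck_row n x" "is_zeck_row n y" for x y
    by (rule fib_type_unique) (use that in \<open>auto simp: is_zeck_row_def\<close>)
qed

lemma is_zeck_row_zeck_row: "is_zeck_row n (zeck_row n)"
  unfolding zeck_row_def by (rule theI'[OF ex1_zeck_row])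

end

theory Submission
  imports Defs
begin

text \<open>
  Let \<open>\<psi> = -1/\<phi>\<close>. Since \<open>F\<^sub>k/\<phi> - F\<^sub>k\<^sub>-\<^sub>1 = -\<psi>\<^sup>k\<close>, in a row built from the bits \<open>\<beta>\<close> the value of
  \<open>\<delta>\<close> at column \<open>j\<close> is \<open>-\<psi>\<^sup>j T\<close> with \<open>T = \<Sum> \<beta>\<^sub>i \<psi>\<^sup>i\<close>. As \<open>\<beta>\<close> starts with \<open>1\<close> and has no two
  consecutive \<open>1\<close>s, \<open>1/\<phi>\<^sup>2 < -T < 1\<close>. So the sign of \<open>\<delta>\<close> is the parity of \<open>j\<close>, and its
  size determines \<open>j\<close> up to an ambiguity which the parity removes. At column \<open>0\<close> the same bounds
  confine \<open>x\<^sub>0\<close> to an open interval of length \<open>1\<close> depending only on \<open>x\<^sub>-\<^sub>1\<close>, so column \<open>-1\<close>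
  determines the row.
\<close>

text \<open>In terms of \<open>successively\<close> the condition splits at either end of a string:
  \<open>fib_sum\<close> recurses on the last bit, \<open>psi_sum\<close> on the first.\<close>

abbreviation no_adjacent_ones :: "bool list \<Rightarrow> bool" where
  "no_adjacent_ones \<equiv> successively (\<lambda>a b. a \<longrightarrow> \<not> b)"

lemma is_zeckendorf_iff:
  "is_zeckendorf m \<beta> \<longleftrightarrow> fib_sum \<beta> = m \<and> \<beta> \<noteq> [] \<and> last \<beta> \<and> no_adjacent_ones \<beta>"
  by (simp add: is_zeckendorf_def successively_conv_nth)

subsection \<open>Zeckendorf's theorem\<close>

lemma fib_sum_Nil [simp]: "fib_sum [] = 0"
  by (simp add: fib_sum_def)

lemma fib_sum_snoc [simp]:
  "fib_sum (\<beta> @ [b]) = fib_sum \<beta> + of_bool b * fib (length \<beta> + 2)"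
proof -
  have "(\<Sum>i = 1..length \<beta>. of_bool ((\<beta> @ [b]) ! (i - 1)) * fib (i + 1)) = fib_sum \<beta>"
    unfolding fib_sum_def by (intro sum.cong) (auto simp: nth_append)
  then show ?thesis
    by (simp add: fib_sum_def)
qed

lemma no_adjacent_ones_snoc:
  "no_adjacent_ones (\<beta> @ [b]) \<longleftrightarrow> no_adjacent_ones \<beta> \<and> \<not> (\<beta> \<noteq> [] \<and> last \<beta> \<and> b)"
  by (auto simp: successively_append_iff)

text \<open>A last bit 1 is preceded by a 0; dropping both leaves a sum below
  \<open>fib (length \<beta>)\<close>, and the last bit adds
  \<open>fib (length \<beta> + 1)\<close>.\<close>

lemma fib_sum_less:
  "no_adjacent_ones \<beta> \<Longrightarrow> fib_sum \<beta> < fib (length \<beta> + 2)"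
proof (induction "length \<beta>" arbitrary: \<beta> rule: less_induct)
  case less
  show ?case
  proof (cases \<beta> rule: rev_cases)
    case Nil
    then show ?thesis by simp
  next
    case (snoc \<gamma> b)
    have \<gamma>: "fib_sum \<gamma> < fib (length \<gamma> + 2)"
      using less snoc by (auto simp: no_adjacent_ones_snoc)
    show ?thesis
    proof (cases b)
      case False
      then show ?thesis using \<gamma> snoc by simp
    next
      case True
      show ?thesis
      proof (cases \<gamma> rule: rev_cases)
        case Nil
        then show ?thesis using snoc True by (simp add: numeral_eq_Suc fib_sum_def)
      next
        case (snoc \<gamma>' c)
        then have "\<not> c" "no_adjacent_ones \<gamma>'"
          using less.prems True \<open>\<beta> = \<gamma> @ [b]\<close> by (auto simp: successively_append_iff)
        then have "fib_sum \<gamma>' < fib (length \<gamma>' + 2)"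
          using less.hyps[of \<gamma>'] snoc \<open>\<beta> = \<gamma> @ [b]\<close> by simp
        then have "fib_sum \<gamma> < fib (length \<gamma> + 1)"
          using snoc \<open>\<not> c\<close> by simp
        then show ?thesis using \<open>\<beta> = \<gamma> @ [b]\<close> True by simp
      qed
    qed
  qed
qed

text \<open>By \<open>fib_sum_less\<close> the last bit is 1 exactly if the sum reaches its weight,
  so the last bits agree and can be stripped.\<close>

lemma fib_sum_inject:
  assumes "length \<beta> = length \<gamma>" "no_adjacent_ones \<beta>" "no_adjacent_ones \<gamma>"
    and "fib_sum \<beta> = fib_sum \<gamma>"
  shows "\<beta> = \<gamma>"
  using assms
proof (induction \<beta> arbitrary: \<gamma> rule: rev_induct)
  case Nil
  then show ?case by simp
next
  case (snoc b \<beta>)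
  then obtain c \<gamma>' where \<gamma>: "\<gamma> = \<gamma>' @ [c]" "length \<gamma>' = length \<beta>"
    by (cases \<gamma> rule: rev_cases) auto
  have "fib_sum \<beta> < fib (length \<beta> + 2)" "fib_sum \<gamma>' < fib (length \<beta> + 2)"
    using fib_sum_less[of \<beta>] fib_sum_less[of \<gamma>'] snoc.prems \<gamma>
    by (auto simp: no_adjacent_ones_snoc)
  then have "b = c"
    using snoc.prems(4) \<gamma> by (cases b; cases c) auto
  then show ?case
    using snoc \<gamma> by (auto simp: no_adjacent_ones_snoc)
qed

text \<open>Greedy choice of the largest weight, padded with zeros to a fixed length.\<close>

lemma ex_no_adjacent_ones_fib_sum:
  "m < fib (l + 2) \<Longrightarrow> \<exists>\<beta>. length \<beta> = l \<and> no_adjacent_ones \<beta> \<and> fib_sum \<beta> = m"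
proof (induction l arbitrary: m rule: fib.induct)
  case 1
  then show ?case by simp
next
  case 2
  then have "m = 0 \<or> m = 1" by (auto simp: numeral_eq_Suc)
  then have "fib_sum [m = 1] = m" by (auto simp: fib_sum_def)
  then show ?case by (intro exI[of _ "[m = 1]"]) simp
next
  case (3 l)
  show ?case
  proof (cases "m < fib (Suc l + 2)")
    case True
    then obtain \<beta> where "length \<beta> = Suc l" "no_adjacent_ones \<beta>" "fib_sum \<beta> = m"
      using 3 by blast
    then show ?thesis
      by (intro exI[of _ "\<beta> @ [False]"]) (simp add: no_adjacent_ones_snoc)
  next
    case False
    \<comment> \<open>The remainder fits into \<open>l\<close> bits, which leaves room for a
      separating zero.\<close>
    then have "m - fib (Suc l + 2) < fib (l + 2)"
      using 3(3) by simp
    then obtain \<beta> where "length \<beta> = l" "no_adjacent_ones \<beta>" "fib_sum \<beta> = m - fib (Suc l + 2)"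
      using 3 by blast
    then show ?thesis using False
      by (intro exI[of _ "(\<beta> @ [False]) @ [True]"])
        (simp add: no_adjacent_ones_snoc del: append_assoc)
  qed
qed

lemma is_zeckendorf_bounds:
  assumes "is_zeckendorf m \<beta>"
  shows "fib (length \<beta> + 1) \<le> m" "m < fib (length \<beta> + 2)"
  using assms fib_sum_less[of \<beta>]
  by (cases \<beta> rule: rev_cases; auto simp: is_zeckendorf_iff)+

text \<open>The intervals of \<open>is_zeckendorf_bounds\<close> are disjoint for different lengths,
  so \<open>m\<close> fixes the length.\<close>

lemma is_zeckendorf_unique:
  assumes "is_zeckendorf m \<beta>" "is_zeckendorf m \<gamma>"
  shows "\<beta> = \<gamma>"
proof -
  have "length \<beta> \<le> length \<gamma>" if "is_zeckendorf m \<beta>" "is_zeckendorf m \<gamma>" for \<beta> \<gamma>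
  proof (rule ccontr)
    assume "\<not> length \<beta> \<le> length \<gamma>"
    then have "fib (length \<gamma> + 2) \<le> fib (length \<beta> + 1)"
      by (intro fib_mono) simp
    then show False
      using is_zeckendorf_bounds[OF that(1)] is_zeckendorf_bounds[OF that(2)] by simp
  qed
  then show ?thesis
    using assms by (intro fib_sum_inject antisym) (auto simp: is_zeckendorf_iff)
qed

lemma less_fib_add_2: "m < fib (m + 2)"
proof (induction m)
  case (Suc m)
  have "0 < fib (Suc m)" by (simp add: fib_neq_0_nat)
  then show ?case using Suc by simp
qed simp

lemma ex_is_zeckendorf:
  assumes "m > 0"
  shows "\<exists>\<beta>. is_zeckendorf m \<beta>"
proof -
  define l where "l = (LEAST l. m < fib (l + 2))"
  have l: "m < fib (l + 2)"
    unfolding l_def using less_fib_add_2 by (rule LeastI[where P = "\<lambda>l. m < fib (l + 2)"])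
  then have "l \<noteq> 0" using assms by (intro notI) simp
  then have l': "fib (l + 1) \<le> m"
    using not_less_Least[of "l - 1" "\<lambda>l. m < fib (l + 2)"] unfolding l_def[symmetric]
    by (cases l) auto
  obtain \<beta> where \<beta>: "length \<beta> = l" "no_adjacent_ones \<beta>" "fib_sum \<beta> = m"
    using ex_no_adjacent_ones_fib_sum[OF l] by blast
  then obtain \<gamma> b where \<gamma>: "\<beta> = \<gamma> @ [b]"
    using \<open>l \<noteq> 0\<close> by (cases \<beta> rule: rev_cases) auto
  \<comment> \<open>With last bit 0 the sum would be that of \<open>\<gamma>\<close>, below
    \<open>fib (l + 1)\<close>, against the minimality of \<open>l\<close>.\<close>
  have "b"
    using fib_sum_less[of \<gamma>] \<beta> \<gamma> l' by (cases b) (auto simp: no_adjacent_ones_snoc)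
  then have "is_zeckendorf m \<beta>"
    using \<beta> \<gamma> by (simp add: is_zeckendorf_iff)
  then show ?thesis ..
qed

lemma zeckendorf_eqI: "is_zeckendorf m \<beta> \<Longrightarrow> zeckendorf m = \<beta>"
  unfolding zeckendorf_def by (blast intro: is_zeckendorf_unique)

lemma is_zeckendorf_zeckendorf: "m > 0 \<Longrightarrow> is_zeckendorf m (zeckendorf m)"
  using ex_is_zeckendorf zeckendorf_eqI by metis

lemma infinite_zeckendorf_low_bit: "infinite {m. m > 0 \<and> zeckendorf m ! 0}"
proof -
  have "\<exists>m > k. m > 0 \<and> zeckendorf m ! 0" for k
  proof -
    \<comment> \<open>At least one zero separates the two ones of \<open>\<beta>\<close>, and the
      weight of the upper one exceeds \<open>k\<close>.\<close>
    define \<gamma> where "\<gamma> = True # replicate (k + 1) False"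
    define \<beta> where "\<beta> = \<gamma> @ [True]"
    have "no_adjacent_ones \<gamma>"
      by (auto simp: \<gamma>_def successively_conv_nth nth_Cons')
    then have "is_zeckendorf (fib_sum \<beta>) \<beta>"
      by (simp add: is_zeckendorf_iff \<beta>_def no_adjacent_ones_snoc) (simp add: \<gamma>_def)
    then have "zeckendorf (fib_sum \<beta>) ! 0"
      by (simp add: zeckendorf_eqI) (simp add: \<beta>_def \<gamma>_def)
    moreover have "k < fib_sum \<beta>"
    proof -
      have "k < fib (k + 2)" by (rule less_fib_add_2)
      also have "\<dots> \<le> fib (length \<gamma> + 2)" by (intro fib_mono) (simp add: \<gamma>_def)
      also have "\<dots> \<le> fib_sum \<beta>" by (simp add: \<beta>_def)
      finally show ?thesis .
    qed
    ultimately show ?thesis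
      by (intro exI[of _ "fib_sum \<beta>"]) simp
  qed
  then show ?thesis by (auto simp: infinite_nat_iff_unbounded)
qed

lemma zeck_a_in: "zeck_a n > 0 \<and> zeckendorf (zeck_a n) ! 0"
  using enumerate_in_set[OF infinite_zeckendorf_low_bit, of "n - 1"]
  by (simp add: zeck_a_def)

text \<open>Index 0 is excluded because truncated subtraction gives
  \<open>zeck_a 0 = zeck_a 1\<close>.\<close>

lemma zeck_a_inject:
  assumes "zeck_a k = zeck_a n" "k \<ge> 1" "n \<ge> 1"
  shows "k = n"
proof -
  have "k - 1 = n - 1"
    using assms(1) strict_mono_eq[OF strict_mono_enumerate[OF infinite_zeckendorf_low_bit]]
    by (simp add: zeck_a_def)
  then show ?thesis using assms(2,3) by simp
qed

subsection \<open>The conjugate sum\<close>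

text \<open>The conjugate of \<open>phi\<close>, the other root of x^2 = x + 1.\<close>

definition psi :: real where
  "psi = - inverse phi"

lemma phi_gt_1: "phi > 1"
  by (simp add: phi_def)

lemma phi_sq: "phi * phi = phi + 1"
  by (simp add: phi_def field_simps)

lemma inverse_phi_sq: "inverse phi * inverse phi = 1 - inverse phi"
  using phi_gt_1 phi_sq by (simp add: field_simps)

lemma inverse_phi_bounds: "0 < inverse phi" "inverse phi < 1"
  using phi_gt_1 by (auto simp: field_simps)

definition psi_sum :: "bool list \<Rightarrow> real" where
  "psi_sum \<beta> = (\<Sum>i = 1..length \<beta>. of_bool (\<beta> ! (i - 1)) * psi ^ i)"

lemma psi_sum_Nil [simp]: "psi_sum [] = 0"
  by (simp add: psi_sum_def)

lemma psi_sum_Cons [simp]: "psi_sum (b # \<beta>) = psi * (of_bool b + psi_sum \<beta>)"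
  unfolding psi_sum_def
  by (simp add: sum.atLeast_Suc_atMost sum.shift_bounds_cl_Suc_ivl sum_distrib_left
      algebra_simps del: sum.cl_ivl_Suc sum_of_bool_mult_eq sum_mult_of_bool_eq)

text \<open>The two cases feed each other: after a 1 the tail is in the second case, after a 0 in
  either, and the Horner step \<open>psi_sum_Cons\<close> maps these ranges to the claimed
  ones.\<close>

lemma psi_sum_bounds:
  assumes "no_adjacent_ones \<beta>"
  shows "if \<beta> \<noteq> [] \<and> hd \<beta> then - 1 < psi_sum \<beta> \<and> psi_sum \<beta> < - (inverse phi)\<^sup>2
         else - (inverse phi)\<^sup>2 < psi_sum \<beta> \<and> psi_sum \<beta> < inverse phi"
  using assms
proof (induction \<beta>)
  case Nil
  then show ?case using inverse_phi_bounds by simp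
next
  case (Cons b \<beta>)
  define p where "p = inverse phi"
  have p: "0 < p" "p < 1" "p * p = 1 - p"
    using inverse_phi_bounds inverse_phi_sq by (auto simp: p_def)
  \<comment> \<open>Here \<open>p - 1\<close> replaces \<open>- (p * p)\<close>, making the bounds
    linear in \<open>p\<close>.\<close>
  have IH: "if \<beta> \<noteq> [] \<and> hd \<beta> then - 1 < psi_sum \<beta> \<and> psi_sum \<beta> < p - 1
         else p - 1 < psi_sum \<beta> \<and> psi_sum \<beta> < p"
    using Cons by (auto simp: successively_Cons p_def[symmetric] power2_eq_square p(3))
  have psi: "psi = - p" by (simp add: psi_def p_def)
  show ?case
  proof (cases b)
    case True
    then have "p - 1 < psi_sum \<beta>" "psi_sum \<beta> < p"
      using IH Cons.prems by (auto simp: successively_Cons split: if_splits)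
    then have "p * p < p * (1 + psi_sum \<beta>)" "p * (1 + psi_sum \<beta>) < p * (1 + p)"
      using p(1) by (auto intro!: mult_strict_left_mono)
    then show ?thesis
      using True p by (simp add: psi p_def[symmetric] power2_eq_square distrib_left)
  next
    case False
    have "- 1 < psi_sum \<beta>" "psi_sum \<beta> < p"
      using IH p by (auto split: if_splits)
    then have "p * - 1 < p * psi_sum \<beta>" "p * psi_sum \<beta> < p * p"
      using p(1) by (auto simp only: mult_less_cancel_left_pos)
    then show ?thesis
      using False by (simp add: psi p_def[symmetric] power2_eq_square)
  qed
qed

lemma fib_psi: "inverse phi * fib (Suc k) - fib k = - (psi ^ Suc k)"
proof (induction k)
  case 0
  then show ?case by (simp add: psi_def)
next
  case (Suc k)
  have "inverse phi * fib (Suc (Suc k)) - fib (Suc k)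
      = inverse phi * fib k - (1 - inverse phi) * fib (Suc k)"
    by (simp add: algebra_simps)
  also have "\<dots> = psi * (inverse phi * fib (Suc k) - fib k)"
    unfolding inverse_phi_sq[symmetric] psi_def by (simp add: algebra_simps)
  finally show ?case using Suc by simp
qed

text \<open>\<open>delta\<close> is linear, and by \<open>fib_psi\<close> bit \<open>i\<close>, with
  weights \<open>fib (i + 1)\<close> and \<open>fib (i + 2)\<close>, contributes
  \<open>- (psi ^ (i + 2))\<close>.\<close>

lemma delta_fib_sum:
  "delta (int (fib_sum \<beta>)) (int (fib_sum (False # \<beta>))) = - psi\<^sup>2 * psi_sum \<beta>"
proof -
  have "fib_sum (False # \<beta>) = (\<Sum>i = 1..length \<beta>. of_bool (\<beta> ! (i - 1)) * fib (i + 2))"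
    unfolding fib_sum_def
    by (simp add: sum.atLeast_Suc_atMost sum.shift_bounds_cl_Suc_ivl nth_Cons'
        del: sum.cl_ivl_Suc) (intro sum.cong, auto)
  then have "delta (int (fib_sum \<beta>)) (int (fib_sum (False # \<beta>)))
    = (\<Sum>i = 1..length \<beta>. of_bool (\<beta> ! (i - 1)) *
         (inverse phi * fib (Suc (i + 1)) - fib (i + 1)))"
    unfolding delta_def fib_sum_def[of \<beta>]
    by (simp add: sum_distrib_left sum_negf[symmetric] sum.distrib[symmetric]
        algebra_simps del: fib.simps sum_of_bool_mult_eq sum_mult_of_bool_eq)
  also have "\<dots> = - psi\<^sup>2 * psi_sum \<beta>"
    unfolding fib_psi psi_sum_def sum_distrib_left
    by (intro sum.cong) (auto simp: power2_eq_square)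
  finally show ?thesis .
qed

subsection \<open>Rows\<close>

lemma zeck_row_rec: "zeck_row n (i + 1) = zeck_row n i + zeck_row n (i - 1)"
  using is_zeck_row_zeck_row[of n] by (simp add: is_zeck_row_def)

text \<open>\<open>delta\<close> is an eigenfunctional of the row recurrence, with eigenvalue
  \<open>psi\<close>.\<close>

lemma delta_step: "delta v (u + v) = psi * delta u v"
proof -
  have "delta v (u + v) = inverse phi * u - (1 - inverse phi) * v"
    by (simp add: delta_def algebra_simps)
  also have "\<dots> = psi * delta u v"
    unfolding inverse_phi_sq[symmetric] psi_def delta_def by (simp add: algebra_simps)
  finally show ?thesis .
qed

lemma delta_zeck_row:
  "delta (zeck_row n (j - 1)) (zeck_row n j)
    = psi powi j * delta (zeck_row n (- 1)) (zeck_row n 0)"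
proof -
  have psi: "psi \<noteq> 0" using inverse_phi_bounds by (simp add: psi_def)
  have step: "delta (zeck_row n i) (zeck_row n (i + 1))
      = psi * delta (zeck_row n (i - 1)) (zeck_row n i)" for i
    by (metis zeck_row_rec delta_step add.commute)
  show ?thesis
  proof (induction j rule: int_induct[where k = 0])
    case base
    then show ?case by simp
  next
    case (step1 i)
    then show ?case using step[of i] psi by (simp add: power_int_add)
  next
    case (step2 i)
    \<comment> \<open>Going down a column, \<open>psi\<close> has to be cancelled rather than
      multiplied in.\<close>
    have "psi * delta (zeck_row n (i - 1 - 1)) (zeck_row n (i - 1))
        = psi * (psi powi (i - 1) * delta (zeck_row n (- 1)) (zeck_row n 0))"
      using step[of "i - 1"] step2 psi by (simp add: power_int_diff)
    then show ?case using psi by simp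
  qed
qed

lemma delta_zeck_row_0_bounds:
  "(inverse phi)\<^sup>2 < delta (zeck_row n (- 1)) (zeck_row n 0)"
  "delta (zeck_row n (- 1)) (zeck_row n 0) < 1"
proof -
  define \<beta> where "\<beta> = zeckendorf (zeck_a n)"
  have \<beta>: "is_zeckendorf (zeck_a n) \<beta>" "\<beta> ! 0"
    using zeck_a_in[of n] is_zeckendorf_zeckendorf by (auto simp: \<beta>_def)
  then have "no_adjacent_ones \<beta>" "\<beta> \<noteq> []" "hd \<beta>" "fib_sum \<beta> = zeck_a n"
    by (auto simp: is_zeckendorf_iff hd_conv_nth)
  then have bounds: "- 1 < psi_sum \<beta>" "psi_sum \<beta> < - (inverse phi)\<^sup>2"
    using psi_sum_bounds[of \<beta>] by auto
  \<comment> \<open>Columns 1 and 2 are the defining ones; moving two columns left cancels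
    \<open>psi\<^sup>2\<close>.\<close>
  have "psi\<^sup>2 * delta (zeck_row n (- 1)) (zeck_row n 0) = psi\<^sup>2 * - psi_sum \<beta>"
    using delta_fib_sum[of \<beta>] delta_zeck_row[of n 2] is_zeck_row_zeck_row[of n]
      \<open>fib_sum \<beta> = zeck_a n\<close>
    by (simp add: is_zeck_row_def \<beta>_def[symmetric])
  then have "delta (zeck_row n (- 1)) (zeck_row n 0) = - psi_sum \<beta>"
    using inverse_phi_bounds unfolding mult_cancel_left by (simp add: psi_def)
  then show "(inverse phi)\<^sup>2 < delta (zeck_row n (- 1)) (zeck_row n 0)"
    "delta (zeck_row n (- 1)) (zeck_row n 0) < 1"
    using bounds by auto
qed

lemma zeck_row_eq_fibz:
  "zeck_row n i = zeck_row n (j - 1) * fibz (i - j) + zeck_row n j * fibz (i - j + 1)"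
proof -
  let ?u = "zeck_row n (j - 1)" and ?v = "zeck_row n j"
  have fibz: "fibz 0 = 0" "fibz 1 = 1" "fibz (- 1) = 1"
    by (auto simp: fibz_def)
  \<comment> \<open>The shift puts columns \<open>j - 1\<close> and \<open>j\<close> at the indices
    1 and 2 that \<open>fib_type_unique\<close> compares.\<close>
  have "(\<lambda>i. zeck_row n (i + j - 2)) = (\<lambda>i. ?u * fibz (i - 2) + ?v * fibz (i - 1))"
  proof (rule fib_type_unique)
    show "zeck_row n (i + 1 + j - 2) = zeck_row n (i + j - 2) + zeck_row n (i - 1 + j - 2)" for i
      using zeck_row_rec[of n "i + j - 2"] by (simp add: algebra_simps)
    show "?u * fibz (i + 1 - 2) + ?v * fibz (i + 1 - 1)
        = ?u * fibz (i - 2) + ?v * fibz (i - 1)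
          + (?u * fibz (i - 1 - 2) + ?v * fibz (i - 1 - 1))" for i
      using fibz_rec[of "i - 1"] fibz_rec[of "i - 2"] by (simp add: algebra_simps)
  qed (simp_all add: fibz)
  from fun_cong[OF this, of "i - j + 2"] show ?thesis
    by (simp add: algebra_simps)
qed

lemma zeck_row_inject:
  assumes "zeck_row k (- 1) = zeck_row n (- 1)" "k \<ge> 1" "n \<ge> 1"
  shows "k = n"
proof -
  define d where "d = real_of_int (zeck_row k 0 - zeck_row n 0)"
  \<comment> \<open>The equal entries in column -1 cancel from the difference of the two
    \<open>delta\<close> values, both in an interval of length 1 - phi^(-2) = 1/phi.\<close>
  have "\<bar>inverse phi * d\<bar> < 1 - (inverse phi)\<^sup>2"
    using delta_zeck_row_0_bounds[of k] delta_zeck_row_0_bounds[of n] assms(1)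
    unfolding delta_def d_def by (simp add: algebra_simps abs_less_iff)
  then have "inverse phi * \<bar>d\<bar> < inverse phi * 1"
    using inverse_phi_bounds by (simp add: power2_eq_square inverse_phi_sq abs_mult)
  then have "\<bar>d\<bar> < 1"
    using inverse_phi_bounds by (simp only: mult_less_cancel_left_pos)
  then have "zeck_row k 0 = zeck_row n 0"
    unfolding d_def by linarith
  then have "zeck_row k 1 = zeck_row n 1"
    using zeck_row_rec[of k 0] zeck_row_rec[of n 0] assms(1) by simp
  then have "zeck_a k = zeck_a n"
    using is_zeck_row_zeck_row[of k] is_zeck_row_zeck_row[of n] by (simp add: is_zeck_row_def)
  then show ?thesis using assms(2,3) by (rule zeck_a_inject)
qed

section \<open>Recovering the column from the sign and size of \<open>delta\<close>\<close>

lemma delta_zeck_row_sign: "delta (zeck_row n (j - 1)) (zeck_row n j) > 0 \<longleftrightarrow> even j"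
proof -
  have "0 < delta (zeck_row n (- 1)) (zeck_row n 0)"
    using delta_zeck_row_0_bounds(1)[of n] zero_le_power2[of "inverse phi"] by linarith
  moreover have "0 < inverse phi powi j"
    using inverse_phi_bounds by simp
  ultimately show ?thesis
    unfolding delta_zeck_row[of n j] psi_def
    by (auto simp: power_int_minus_left zero_less_mult_iff)
qed

text \<open>The logarithm is \<open>- j\<close> plus that of the column 0 value, which lies strictly
  between -2 and 0.\<close>

lemma ceiling_log_delta_zeck_row:
  "\<lceil>log phi \<bar>delta (zeck_row n (j - 1)) (zeck_row n j)\<bar>\<rceil> \<in> {- j - 1, - j}"
proof -
  define t where "t = delta (zeck_row n (- 1)) (zeck_row n 0)"
  have t: "phi powr (- 2) < t" "t < 1"
    using delta_zeck_row_0_bounds[of n] phi_gt_1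
    by (auto simp: t_def powr_minus power_inverse)
  then have "t > 0"
    using powr_ge_zero[of phi "- 2"] by linarith
  have "\<bar>psi powi j\<bar> = phi powr (- j)"
    using phi_gt_1
    by (simp add: psi_def power_int_abs powr_minus powr_real_of_int' power_int_inverse)
  then have "log phi \<bar>delta (zeck_row n (j - 1)) (zeck_row n j)\<bar> = - j + log phi t"
    using \<open>t > 0\<close> phi_gt_1
    by (simp add: delta_zeck_row[of n j] t_def[symmetric] abs_mult log_mult)
  moreover have "- 2 < log phi t" "log phi t < 0"
    using t \<open>t > 0\<close> phi_gt_1 by (simp_all add: less_log_iff)
  ultimately show ?thesis by (simp add: ceiling_eq_iff) linarith
qed

theorem theorem4:
  fixes u v j m :: int and n :: nat
  assumes "anderson_pair u v"
    and "n \<ge> 1" and "u = zeck_row n (j - 1)" and "v = zeck_row n j"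
    and "m = \<lceil>log phi \<bar>delta u v\<bar>\<rceil>"
  shows "j = (if delta u v > 0 then 2 * \<lfloor>- real_of_int m / 2\<rfloor>
              else 2 * \<lfloor>(1 - real_of_int m) / 2\<rfloor> - 1)
    \<and> zeck_row n (-1) = u * fibz (-1 - j) + v * fibz (- j)
    \<and> (\<forall>k\<ge>1. zeck_row k (-1) = zeck_row n (-1) \<longrightarrow> k = n)"
proof (intro conjI allI impI)
  have sign: "delta u v > 0 \<longleftrightarrow> even j"
    using delta_zeck_row_sign assms(3,4) by simp
  have "m \<in> {- j - 1, - j}"
    using ceiling_log_delta_zeck_row assms(3-5) by simp
  moreover have "\<lfloor>- real_of_int m / 2\<rfloor> = - m div 2"
    "\<lfloor>(1 - real_of_int m) / 2\<rfloor> = (1 - m) div 2"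
    using floor_divide_of_int_eq[of "- m" 2] floor_divide_of_int_eq[of "1 - m" 2] by simp_all
  \<comment> \<open>Thus \<open>j\<close> is \<open>- m\<close> or \<open>- m - 1\<close>: the even
    one is the largest even number up to \<open>- m\<close>, the odd one the largest odd number up
    to \<open>- m\<close>.\<close>
  ultimately show "j = (if delta u v > 0 then 2 * \<lfloor>- real_of_int m / 2\<rfloor>
              else 2 * \<lfloor>(1 - real_of_int m) / 2\<rfloor> - 1)"
    unfolding sign by (simp split: if_splits) presburger
  show "zeck_row n (-1) = u * fibz (-1 - j) + v * fibz (- j)"
    using zeck_row_eq_fibz[of n "- 1" j] assms(3,4) by simp
  show "k = n" if "k \<ge> 1" "zeck_row k (-1) = zeck_row n (-1)" for k
    using zeck_row_inject that assms(2) by simp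
qed

end
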